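(* The only extensional object in the category of groups is the trivial group; that is, a group $I$ is an extensional object if and only if $I = \{1\}$.
   Context: A group $I$ is called an extensional object (in the category of groups) if, for all groups $N$ and $G$, any monomorphism $f: N \rightarrow G$ such that $f(N) \unlhd G$, and any morphism $\varphi: N \rightarrow I$, there is a morphism $h: G \rightarrow I$ such that $h \circ f = \varphi$. Morphisms are group homomorphisms and monomorphisms are injective homomorphisms. *)

theory Defs
  imports "HOL-Algebra.Algebra" "HOL-Library.Infinite_Typeclass"
begin

text \<open>
  HOL cannot quantify over the groups on all types at once, so ``for all groups N and G'' ranges over
  the groups whose carrier is a subset of a type \<open>'u\<close>, which is a parameter of the notion. \<open>'u\<close> must
  be infinite: over a one-element universe, for instance, every group would be extensional. Every
  group occurs in some such universe, since \<open>'u\<close> may be chosen arbitrarily large.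
\<close>

definition extensional_object ::
  "'u::infinite itself \<Rightarrow> ('a, 'm) monoid_scheme \<Rightarrow> bool" where
  "extensional_object U I \<longleftrightarrow>
     group I \<and>
     (\<forall>(N :: 'u monoid) (G :: 'u monoid) f \<phi>.
        group N \<longrightarrow> group G \<longrightarrow>
        f \<in> mon N G \<longrightarrow> f ` carrier N \<lhd> G \<longrightarrow> \<phi> \<in> hom N I \<longrightarrow>
        (\<exists>h \<in> hom G I. \<forall>x \<in> carrier N. h (f x) = \<phi> x))"

end

theory Submission
  imports Defs
begin

text \<open>
  If a homomorphism on a normal subgroup \<open>N\<close> of \<open>G\<close> extends to \<open>G\<close>, its kernel is \<open>N \<inter> ker h\<close>,
  hence normal in \<open>G\<close>. For \<open>a \<noteq> 1\<close> in \<open>I\<close>, the map \<open>(x, y) \<mapsto> a\<^sup>x\<close> on the base group of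
  the wreath product of the integers by the group of order two has a kernel which contains \<open>(0, 1)\<close>
  but not its conjugate \<open>(1, 0)\<close>, so it does not extend. As the wreath product is countable, it has
  a copy in every infinite universe.
\<close>

text \<open>An infinite type contains a copy of the natural numbers, and these enumerate
  \<open>A\<close>. This makes any infinite universe large enough for every countable group.\<close>

lemma countable_inj_on_infinite_type:
  assumes "countable A"
  obtains g :: "'b \<Rightarrow> 'u::infinite" where "inj_on g A"
proof -
  obtain e :: "nat \<Rightarrow> 'u" where "inj e"
    using infinite_UNIV infinite_countable_subset by blast
  then have "inj_on (e \<circ> to_nat_on A) A"
    by (meson assms comp_inj_on inj_on_subset inj_on_to_nat_on subset_UNIV)
  then show ?thesis
    by (rule that)
qed

text \<open>This frees the extension property from the universe \<open>'u\<close>: a countable group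
  on any type can be copied into \<open>'u\<close>, and the extension found there is pulled back
  along the copying isomorphism.\<close>

lemma extensional_object_extend:
  fixes G :: "('b, 'n) monoid_scheme"
  assumes ext: "extensional_object TYPE('u::infinite) I"
    and G: "group G" "countable (carrier G)" and H: "H \<lhd> G"
    and \<phi>: "\<phi> \<in> hom (G\<lparr>carrier := H\<rparr>) I"
  shows "\<exists>h \<in> hom G I. \<forall>x \<in> H. h x = \<phi> x"
proof -
  obtain g :: "'b \<Rightarrow> 'u" where g: "inj_on g (carrier G)"
    using countable_inj_on_infinite_type[OF G(2)] by blast
  \<comment> \<open>\<open>P\<close> and \<open>N\<close> are the copies of \<open>G\<close> and
    \<open>H\<close> inside \<open>'u\<close>; \<open>k\<close> undoes \<open>g\<close>, so
    \<open>\<phi> \<circ> k\<close> is \<open>\<phi>\<close> read on the copy of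
    \<open>H\<close>.\<close>
  define P where "P = image_group g G"
  define N where "N = P\<lparr>carrier := g ` H\<rparr>"
  define k where "k = inv_into (carrier G) g"
  have giso: "g \<in> iso G P"
    unfolding P_def by (rule inj_imp_image_group_iso[OF g])
  have P: "group P"
    unfolding P_def by (rule group.inj_imp_image_group_is_group[OF G(1) g])
  have gH: "g ` H \<lhd> P"
    by (rule iso_normal_subgroup[OF giso G(1) P H])
  have N: "group N"
    unfolding N_def using P gH by (simp add: group.subgroup_imp_group normal_imp_subgroup)
  have sub: "H \<subseteq> carrier G"
    using H by (simp add: normal_imp_subgroup subgroup.subset)
  have kg: "k (g x) = x" if "x \<in> carrier G" for x
    using that g by (simp add: k_def)
  have closed: "x \<otimes>\<^bsub>G\<^esub> y \<in> H" if "x \<in> H" "y \<in> H" for x y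
    using that H by (simp add: normal_imp_subgroup subgroup.m_closed)
  have gmult: "g x \<otimes>\<^bsub>P\<^esub> g y = g (x \<otimes>\<^bsub>G\<^esub> y)" if "x \<in> H" "y \<in> H" for x y
    using that sub giso by (simp add: iso_def hom_def subset_iff)
  have "\<phi> \<circ> k \<in> hom N I"
  proof (rule homI)
    show "(\<phi> \<circ> k) x \<in> carrier I" if "x \<in> carrier N" for x
      using that sub \<phi> by (auto simp: N_def kg subset_iff hom_def)
    show "(\<phi> \<circ> k) (x \<otimes>\<^bsub>N\<^esub> y) = (\<phi> \<circ> k) x \<otimes>\<^bsub>I\<^esub> (\<phi> \<circ> k) y"
      if xy: "x \<in> carrier N" "y \<in> carrier N" for x y
    proof -
      obtain u v where uv: "u \<in> H" "v \<in> H" "x = g u" "y = g v"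
        using xy by (auto simp: N_def)
      have "\<phi> (u \<otimes>\<^bsub>G\<^esub> v) = \<phi> u \<otimes>\<^bsub>I\<^esub> \<phi> v"
        using uv \<phi> by (simp add: hom_def)
      then show ?thesis
        using uv sub closed[of u v] by (auto simp: N_def gmult kg subset_iff)
    qed
  qed
  \<comment> \<open>The monomorphism to extend along is the inclusion of \<open>N\<close> in
    \<open>P\<close>.\<close>
  moreover have "id \<in> mon N P"
    using gH by (auto simp: mon_def hom_def N_def P_def image_group_def
      dest!: normal_imp_subgroup subgroup.subset)
  moreover have "id ` carrier N \<lhd> P"
    using gH by (simp add: N_def)
  ultimately obtain h where h: "h \<in> hom P I" "\<forall>x \<in> carrier N. h (id x) = (\<phi> \<circ> k) x"
    using ext N P unfolding extensional_object_def by blast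
  have "h \<circ> g \<in> hom G I"
    using giso h(1) by (auto intro: hom_compose simp: iso_def)
  moreover have "\<forall>x \<in> H. (h \<circ> g) x = \<phi> x"
    using h(2) sub by (auto simp: N_def kg subset_iff)
  ultimately show ?thesis
    by blast
qed

text \<open>The triple \<open>(x, y, s)\<close> stands for the pair \<open>(x, y)\<close> followed
  by the swap if \<open>s\<close> holds. Moving a swap to the right past a pair exchanges its
  coordinates; \<open>s \<noteq> t\<close> is addition modulo 2.\<close>

definition int_wreath_C2 :: "(int \<times> int \<times> bool) monoid" where
  "int_wreath_C2 =
     \<lparr>carrier = UNIV,
      monoid.mult = (\<lambda>(x, y, s) (x', y', t).
        if s then (x + y', y + x', s \<noteq> t) else (x + x', y + y', s \<noteq> t)),
      one = (0, 0, False)\<rparr>"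

definition int_wreath_base :: "(int \<times> int \<times> bool) set" where
  "int_wreath_base = {(x, y, s). \<not> s}"

lemma group_int_wreath_C2: "group int_wreath_C2"
proof (rule groupI)
  fix p assume "p \<in> carrier int_wreath_C2"
  obtain x y s where p: "p = (x, y, s)"
    by (cases p)
  show "\<exists>q \<in> carrier int_wreath_C2. q \<otimes>\<^bsub>int_wreath_C2\<^esub> p = \<one>\<^bsub>int_wreath_C2\<^esub>"
    \<comment> \<open>With a swap present, the negated coordinates must trade places, since the swap
      in the left factor exchanges those of \<open>p\<close>.\<close>
    by (rule bexI[of _ "if s then (- y, - x, True) else (- x, - y, False)"])
      (auto simp: int_wreath_C2_def p)
qed (auto simp: int_wreath_C2_def split: if_splits)

text \<open>The base is the kernel of the projection onto the group of order two, here the integers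
  modulo 2.\<close>

lemma int_wreath_base_normal: "int_wreath_base \<lhd> int_wreath_C2"
proof -
  interpret W: group int_wreath_C2
    by (rule group_int_wreath_C2)
  define \<pi> where "\<pi> = (\<lambda>(x :: int, y :: int, s). if s then 1 else 0 :: int)"
  have "group_hom int_wreath_C2 (integer_mod_group 2) \<pi>"
    by (auto simp: group_hom_def group_hom_axioms_def hom_def \<pi>_def int_wreath_C2_def
      carrier_integer_mod_group mult_integer_mod_group group_int_wreath_C2[unfolded int_wreath_C2_def])
  then have "kernel int_wreath_C2 (integer_mod_group 2) \<pi> \<lhd> int_wreath_C2"
    by (rule group_hom.normal_kernel)
  also have "kernel int_wreath_C2 (integer_mod_group 2) \<pi> = int_wreath_base"
    by (auto simp: kernel_def int_wreath_base_def \<pi>_def int_wreath_C2_def split: if_splits)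
  finally show ?thesis .
qed

lemma extensional_object_imp_trivial:
  assumes ext: "extensional_object TYPE('u::infinite) I"
  shows "carrier I = {\<one>\<^bsub>I\<^esub>}"
proof -
  interpret I: group I
    using ext by (simp add: extensional_object_def)
  have "a = \<one>\<^bsub>I\<^esub>" if a: "a \<in> carrier I" for a
  proof -
    define \<phi> where "\<phi> = (\<lambda>(x :: int, y :: int, s :: bool). a [^]\<^bsub>I\<^esub> x)"
    have "\<phi> \<in> hom (int_wreath_C2\<lparr>carrier := int_wreath_base\<rparr>) I"
      using a by (auto simp: hom_def \<phi>_def int_wreath_C2_def int_wreath_base_def I.int_pow_mult)
    then obtain h where h: "h \<in> hom int_wreath_C2 I"
      and h\<phi>: "\<forall>p \<in> int_wreath_base. h p = \<phi> p"
      using extensional_object_extend[OF ext group_int_wreath_C2 _ int_wreath_base_normal]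
      by blast
    let ?s = "(0, 0, True) :: int \<times> int \<times> bool"
    have car: "p \<in> carrier int_wreath_C2" for p
      by (simp add: int_wreath_C2_def)
    have hcar: "h p \<in> carrier I" for p
      using hom_in_carrier[OF h car] .
    have e1: "h (1, 0, False) = a" and e0: "h (0, 1, False) = \<one>\<^bsub>I\<^esub>"
      using h\<phi> a by (auto simp: \<phi>_def int_wreath_base_def)
    \<comment> \<open>The conjugacy of \<open>(1, 0)\<close> and \<open>(0, 1)\<close> under the
      swap, stated without inverses. Applying \<open>h\<close> gives \<open>a\<close> times
      \<open>h ?s\<close> equal to \<open>h ?s\<close>, and cancelling forces \<open>a\<close> to be
      the identity.\<close>
    have "(1, 0, False) \<otimes>\<^bsub>int_wreath_C2\<^esub> ?s = ?s \<otimes>\<^bsub>int_wreath_C2\<^esub> (0, 1, False)"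
      by (simp add: int_wreath_C2_def)
    then have "h (1, 0, False) \<otimes>\<^bsub>I\<^esub> h ?s = h ?s \<otimes>\<^bsub>I\<^esub> h (0, 1, False)"
      by (metis h car hom_mult)
    then show ?thesis
      using a hcar[of ?s] I.r_cancel_one by (simp add: e0 e1)
  qed
  then show ?thesis
    by auto
qed

theorem theorem4p2:
  fixes I :: "('a, 'm) monoid_scheme"
  assumes "group I"
  shows "extensional_object TYPE('u::infinite) I \<longleftrightarrow> carrier I = {\<one>\<^bsub>I\<^esub>}"
proof
  assume "extensional_object TYPE('u) I"
  then show "carrier I = {\<one>\<^bsub>I\<^esub>}"
    by (rule extensional_object_imp_trivial)
next
  interpret group I
    by (rule assms)
  assume triv: "carrier I = {\<one>\<^bsub>I\<^esub>}"
  \<comment> \<open>Any \<open>\<phi>\<close> into a trivial group is constant, so the constant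
    homomorphism on \<open>G\<close> extends it.\<close>
  have "\<exists>h \<in> hom G I. \<forall>x \<in> carrier N. h (f x) = \<phi> x"
    if "\<phi> \<in> hom N I" for N G :: "'u monoid" and f \<phi>
  proof -
    have "\<phi> x = \<one>\<^bsub>I\<^esub>" if "x \<in> carrier N" for x
      using hom_in_carrier[OF \<open>\<phi> \<in> hom N I\<close> that] triv by simp
    moreover have "(\<lambda>_. \<one>\<^bsub>I\<^esub>) \<in> hom G I"
      by (simp add: hom_def)
    ultimately show ?thesis
      by (intro bexI[of _ "\<lambda>_. \<one>\<^bsub>I\<^esub>"]) simp_all
  qed
  then show "extensional_object TYPE('u) I"
    using assms unfolding extensional_object_def by blast
qed

end
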